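(* Let $\mathcal{M}\subseteq\mathbb{R}^n$ be a compact manifold and let $T:\mathcal{M}\to\mathcal{M}$ be a $\mathcal{C}^1$ map defining the discrete-time system $x_{t+1}=T(x_t)$. Suppose that this system has $v$ invariant subspaces $\{M_i\}_{i=1}^v$ with $M_i\cap M_j=\emptyset$ for $i\neq j$. Let $M_p\subset\mathcal{M}$ be a Koopman-invariant subspace, with dictionary $\Psi_p:\mathcal{M}\to\mathbb{C}^N$ and corresponding Koopman operator $\mathcal{K}_p\in\mathbb{C}^{N\times N}$ trained on $\Psi_p$, so that the span of the observables in $\Psi_p$ is invariant under $\mathcal{K}_p$. Then, for every (nonempty) set $M_q\subset\mathcal{M}$ and every $n\in\mathbb{N}$, $$\mathcal{E}_q(\Psi_p,n)\;\ge\;\mathcal{E}_p(\Psi_p,n).$$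
   Context: "Subspace" of the phase space means subset. A subset $M\subseteq\mathcal{M}$ is (positively) invariant if $T^n(x_0)\in M$ for every $x_0\in M$ and all $n\in\mathbb{N}$. All invariant subsets considered, in particular $M_p$, are nonempty and have compact closure. An observable is a scalar function $\psi:\mathcal{M}\to\mathbb{C}$; the Koopman operator of the system acts on observables by $[\mathbb{U}\psi](x)=\psi(T(x))$. The dictionary $\Psi_p=(\psi^p_1,\dots,\psi^p_N)^\top$ is a vector of bounded observables, and $\mathcal{K}_p$ is the matrix representing (finite-dimensionally) the Koopman operator on $M_p$ with respect to $\Psi_p$. The set $M_p$ is called a Koopman-invariant subspace if it is an invariant subset and the span of the observables in $\Psi_p$ is invariant under the action of the Koopman operator $\mathcal{K}_p$ on $M_p$, i.e. $\Psi_p(T(x))=\mathcal{K}_p\Psi_p(x)$ for all $x\in M_p$. For a nonempty set $M_r\subseteq\mathcal{M}$ (with $r=p$ or $r=q$) the $n$-step prediction error on $M_r$ of the pair $(\Psi_p,\mathcal{K}_p)$ is $$\mathcal{E}_r(\Psi_p,n):=\max_{x_0\in M_r}\big\|\Psi_p(T^n(x_0))-\mathcal{K}_p^{\,n}\,\Psi_p(x_0)\big\|,$$ where $\mathcal{K}_p^{\,n}$ is the $n$-th matrix power, $\|\cdot\|$ is a norm on $\mathbb{C}^N$, and the maximum is understood as a supremum if it is not attained. The subscript $r$ indicates only the set from which the initial condition is taken; dictionary and matrix are those of $M_p$. *)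

theory Defs
  imports "HOL-Analysis.Analysis"
begin

definition C1_on :: "'a::real_normed_vector set \<Rightarrow> ('a \<Rightarrow> 'b::real_normed_vector) \<Rightarrow> bool" where
  "C1_on U f \<longleftrightarrow>
     (\<exists>f'. (\<forall>x\<in>U. (f has_derivative blinfun_apply (f' x)) (at x)) \<and> continuous_on U f')"

text \<open>Embedded submanifolds of Euclidean space without boundary, of regularity C1 (so that smooth
  submanifolds are included), given by slice charts: near each of its points, M is straightened
  to an m-dimensional linear subspace by a C1 diffeomorphism of ambient open sets.\<close>

definition C1_submanifold :: "nat \<Rightarrow> 'a::euclidean_space set \<Rightarrow> bool" where
  "C1_submanifold m M \<longleftrightarrow>
     (\<forall>x\<in>M. \<exists>U V \<phi> \<phi>' S.
        open U \<and> x \<in> U \<and> open V \<and>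
        homeomorphism U V \<phi> \<phi>' \<and> C1_on U \<phi> \<and> C1_on V (\<phi>' :: 'a \<Rightarrow> 'a) \<and>
        subspace S \<and> dim S = m \<and> \<phi> ` (U \<inter> M) = V \<inter> S)"

text \<open>C1 regularity of a map on a subset that need not be open, via local C1 extensions to
  the ambient space.\<close>

definition C1_map_on :: "'a::real_normed_vector set \<Rightarrow> ('a \<Rightarrow> 'b::real_normed_vector) \<Rightarrow> bool" where
  "C1_map_on M f \<longleftrightarrow>
     (\<forall>x\<in>M. \<exists>U g. open U \<and> x \<in> U \<and> C1_on U g \<and> (\<forall>y\<in>U \<inter> M. g y = f y))"

definition invariant_subset ::
    "'a::topological_space set \<Rightarrow> ('a \<Rightarrow> 'a) \<Rightarrow> 'a set \<Rightarrow> bool" where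
  "invariant_subset M T A \<longleftrightarrow>
     A \<subseteq> M \<and> A \<noteq> {} \<and> compact (closure A) \<and> (\<forall>x\<in>A. \<forall>n. (T ^^ n) x \<in> A)"

definition koopman :: "('a \<Rightarrow> 'a) \<Rightarrow> ('a \<Rightarrow> complex) \<Rightarrow> 'a \<Rightarrow> complex" where
  "koopman T \<psi> = (\<lambda>x. \<psi> (T x))"

text \<open>A dictionary is a vector-valued function whose components are the observables.
  The last conjunct is the equation \<open>\<Psi> (T x) = K *v \<Psi> x\<close> on A, with the left-hand side
  expressed by the action of the Koopman operator on each observable.\<close>

definition koopman_invariant ::
    "'a::topological_space set \<Rightarrow> ('a \<Rightarrow> 'a) \<Rightarrow> 'a set \<Rightarrow>
     ('a \<Rightarrow> complex ^ 'N) \<Rightarrow> complex ^ 'N ^ 'N \<Rightarrow> bool" where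
  "koopman_invariant M T A \<Psi> K \<longleftrightarrow>
     invariant_subset M T A \<and>
     (\<forall>x\<in>A. (\<chi> i. koopman T (\<lambda>y. \<Psi> y $ i) x) = K *v \<Psi> x)"

text \<open>An arbitrary norm on the complex vector space, not only the Euclidean one of the type.\<close>

definition is_vector_norm :: "(complex ^ 'N \<Rightarrow> real) \<Rightarrow> bool" where
  "is_vector_norm \<nu> \<longleftrightarrow>
     (\<forall>x. 0 \<le> \<nu> x) \<and> (\<forall>x. \<nu> x = 0 \<longleftrightarrow> x = 0) \<and>
     (\<forall>c x. \<nu> (c *s x) = cmod c * \<nu> x) \<and> (\<forall>x y. \<nu> (x + y) \<le> \<nu> x + \<nu> y)"

text \<open>The operation \<open>^\<close> on this type would be the entrywise power, hence a separate definition.\<close>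

primrec matrix_power :: "'a::semiring_1 ^ 'N ^ 'N \<Rightarrow> nat \<Rightarrow> 'a ^ 'N ^ 'N" where
  "matrix_power A 0 = mat 1"
| "matrix_power A (Suc n) = A ** matrix_power A n"

text \<open>The supremum is taken in the reals; it is a genuine one when the set A of initial conditions
  is nonempty and \<open>\<Psi>\<close> is bounded on a T-invariant set containing A.\<close>

definition prediction_error ::
    "(complex ^ 'N \<Rightarrow> real) \<Rightarrow> ('a \<Rightarrow> 'a) \<Rightarrow> 'a set \<Rightarrow>
     ('a \<Rightarrow> complex ^ 'N) \<Rightarrow> complex ^ 'N ^ 'N \<Rightarrow> nat \<Rightarrow> real" where
  "prediction_error \<nu> T A \<Psi> K n =
     (SUP x\<in>A. \<nu> (\<Psi> ((T ^^ n) x) - matrix_power K n *v \<Psi> x))"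

end

theory Submission imports Defs begin

text \<open>On the Koopman-invariant set the relation \<open>\<Psi> (T x) = K *v \<Psi> x\<close> holds at every point of each
  orbit, because the orbit stays in the set.  Iterating it shows that the \<open>n\<close>-th power of \<open>K\<close> predicts
  the dictionary exactly there, so the prediction error on \<open>Mp\<close> is zero.  On any other nonempty set
  of initial conditions the error is a supremum of norms and is therefore nonnegative.

  For real suprema the second half requires the set of norms to be bounded above.  This is where the
  boundedness of the dictionary enters: orbits starting in \<open>Mq\<close> stay in \<open>M\<close>, so the prediction
  residuals form a bounded set, and an arbitrary norm on a finite-dimensional complex space is
  bounded on bounded sets.  The last fact is one half of the equivalence of norms in finite dimension
  (\<open>is_vector_norm_le_euclidean\<close>).\<close>

lemma is_vector_norm_sum_le:
  fixes \<nu> :: "complex ^ 'N \<Rightarrow> real"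
  assumes "is_vector_norm \<nu>" "finite S"
  shows "\<nu> (\<Sum>i\<in>S. f i) \<le> (\<Sum>i\<in>S. \<nu> (f i))"
  using assms(2)
proof (induction S rule: finite_induct)
  case empty
  have "\<nu> 0 = 0" using assms(1) unfolding is_vector_norm_def by blast
  then show ?case by simp
next
  case (insert i S)
  have "\<nu> (f i + sum f S) \<le> \<nu> (f i) + \<nu> (sum f S)"
    using assms(1) by (simp add: is_vector_norm_def)
  then show ?case using insert by simp
qed

text \<open>Expanding \<open>y\<close> in the standard basis bounds \<open>\<nu> y\<close> by the values of \<open>\<nu>\<close> at the basis vectors,
  weighted by the components of \<open>y\<close>, each of which is at most the Euclidean norm.\<close>

lemma is_vector_norm_le_euclidean:
  fixes \<nu> :: "complex ^ 'N \<Rightarrow> real"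
  assumes "is_vector_norm \<nu>"
  shows "\<nu> y \<le> (\<Sum>i\<in>UNIV. \<nu> (axis i 1)) * norm y"
proof -
  have "\<nu> y = \<nu> (\<Sum>i\<in>UNIV. (y $ i) *s axis i 1)"
    by (simp add: basis_expansion)
  also have "\<dots> \<le> (\<Sum>i\<in>UNIV. \<nu> ((y $ i) *s axis i 1))"
    by (rule is_vector_norm_sum_le[OF assms finite])
  also have "\<dots> = (\<Sum>i\<in>UNIV. cmod (y $ i) * \<nu> (axis i 1))"
    using assms by (simp add: is_vector_norm_def)
  also have "\<dots> \<le> (\<Sum>i\<in>UNIV. norm y * \<nu> (axis i 1))"
    using assms by (intro sum_mono mult_right_mono)
      (simp_all add: is_vector_norm_def Finite_Cartesian_Product.norm_nth_le)
  finally show ?thesis by (simp add: sum_distrib_left mult.commute)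
qed

lemma is_vector_norm_bdd_above_image:
  fixes \<nu> :: "complex ^ 'N \<Rightarrow> real"
  assumes "is_vector_norm \<nu>" "bounded S"
  shows "bdd_above (\<nu> ` S)"
proof -
  obtain b where b: "\<And>y. y \<in> S \<Longrightarrow> norm y \<le> b"
    using assms(2) by (auto simp: bounded_iff)
  have C: "0 \<le> (\<Sum>i\<in>UNIV. \<nu> (axis i 1))"
    using assms(1) by (intro sum_nonneg) (simp add: is_vector_norm_def)
  show ?thesis
  proof (rule bdd_aboveI2)
    fix y assume "y \<in> S"
    have "\<nu> y \<le> (\<Sum>i\<in>UNIV. \<nu> (axis i 1)) * norm y"
      by (rule is_vector_norm_le_euclidean[OF assms(1)])
    also have "\<dots> \<le> (\<Sum>i\<in>UNIV. \<nu> (axis i 1)) * b"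
      by (rule mult_left_mono[OF b[OF \<open>y \<in> S\<close>] C])
    finally show "\<nu> y \<le> (\<Sum>i\<in>UNIV. \<nu> (axis i 1)) * b" .
  qed
qed

lemma bounded_image_if_components_bounded:
  fixes f :: "'a \<Rightarrow> complex ^ 'N"
  assumes "\<And>i. bounded ((\<lambda>x. f x $ i) ` S)"
  shows "bounded (f ` S)"
proof -
  have "\<exists>b. \<forall>x\<in>S. cmod (f x $ i) \<le> b" for i
    using assms[of i] by (simp add: bounded_iff)
  then obtain B where B: "\<And>i x. x \<in> S \<Longrightarrow> cmod (f x $ i) \<le> B i"
    by metis
  have "norm (f x) \<le> (\<Sum>i\<in>UNIV. B i)" if "x \<in> S" for x
  proof -
    have "norm (f x) \<le> (\<Sum>i\<in>UNIV. cmod (f x $ i))"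
      unfolding norm_vec_def by (rule L2_set_le_sum) simp
    also have "\<dots> \<le> (\<Sum>i\<in>UNIV. B i)"
      by (intro sum_mono B that)
    finally show ?thesis .
  qed
  then show ?thesis by (auto simp: bounded_iff)
qed

lemma funpow_mem:
  assumes "T ` M \<subseteq> M" "x \<in> M"
  shows "(T ^^ n) x \<in> M"
  using assms by (induction n) auto

lemma koopman_invariant_iterate:
  fixes \<Psi> :: "'a::topological_space \<Rightarrow> complex ^ 'N"
  assumes "koopman_invariant M T A \<Psi> K" "x \<in> A"
  shows "\<Psi> ((T ^^ n) x) = matrix_power K n *v \<Psi> x"
proof (induction n)
  case 0
  then show ?case by simp
next
  case (Suc n)
  have "(T ^^ n) x \<in> A"
    using assms by (simp add: koopman_invariant_def invariant_subset_def)
  then have "\<Psi> (T ((T ^^ n) x)) = K *v \<Psi> ((T ^^ n) x)"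
    using assms(1) by (simp add: koopman_invariant_def koopman_def)
  then show ?case
    using Suc by (simp add: matrix_vector_mul_assoc)
qed

lemma prediction_error_koopman_invariant:
  assumes "koopman_invariant M T A \<Psi> K" "is_vector_norm \<nu>"
  shows "prediction_error \<nu> T A \<Psi> K n = 0"
proof -
  have "A \<noteq> {}"
    using assms(1) by (simp add: koopman_invariant_def invariant_subset_def)
  moreover have "\<nu> (\<Psi> ((T ^^ n) x) - matrix_power K n *v \<Psi> x) = 0" if "x \<in> A" for x
    using koopman_invariant_iterate[OF assms(1) that, of n] assms(2)
    by (simp add: is_vector_norm_def)
  ultimately show ?thesis by (simp add: prediction_error_def)
qed

text \<open>The residual at \<open>x\<close> is a difference of two terms that range over bounded sets: a value of the
  dictionary on \<open>M\<close>, and the image of such a value under a bounded linear map.\<close>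

lemma bounded_prediction_residuals:
  fixes \<Psi> :: "'a \<Rightarrow> complex ^ 'N"
  assumes "bounded (\<Psi> ` M)" "T ` M \<subseteq> M" "A \<subseteq> M"
  shows "bounded ((\<lambda>x. \<Psi> ((T ^^ n) x) - matrix_power K n *v \<Psi> x) ` A)"
proof (rule bounded_minus_comp)
  have "(\<lambda>x. \<Psi> ((T ^^ n) x)) ` A \<subseteq> \<Psi> ` M"
    using funpow_mem[OF assms(2)] assms(3) by blast
  then show "bounded ((\<lambda>x. \<Psi> ((T ^^ n) x)) ` A)"
    by (rule bounded_subset[OF assms(1)])
  have "bounded ((*v) (matrix_power K n) ` \<Psi> ` M)"
    using assms(1) matrix_vector_mul_bounded_linear by (rule bounded_linear_image)
  moreover have "(\<lambda>x. matrix_power K n *v \<Psi> x) ` A \<subseteq> (*v) (matrix_power K n) ` \<Psi> ` M"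
    using assms(3) by blast
  ultimately show "bounded ((\<lambda>x. matrix_power K n *v \<Psi> x) ` A)"
    by (rule bounded_subset)
qed

lemma prediction_error_nonneg:
  fixes \<Psi> :: "'a \<Rightarrow> complex ^ 'N"
  assumes "is_vector_norm \<nu>" "bounded (\<Psi> ` M)" "T ` M \<subseteq> M" "A \<subseteq> M" "A \<noteq> {}"
  shows "0 \<le> prediction_error \<nu> T A \<Psi> K n"
proof -
  let ?r = "\<lambda>x. \<Psi> ((T ^^ n) x) - matrix_power K n *v \<Psi> x"
  obtain x where x: "x \<in> A" using assms(5) by blast
  have "bdd_above (\<nu> ` ?r ` A)"
    using assms(1) bounded_prediction_residuals[OF assms(2-4)]
    by (rule is_vector_norm_bdd_above_image)
  then have bdd: "bdd_above ((\<lambda>x. \<nu> (?r x)) ` A)"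
    by (simp add: image_image)
  have "0 \<le> \<nu> (?r x)"
    using assms(1) by (simp add: is_vector_norm_def)
  also have "\<dots> \<le> prediction_error \<nu> T A \<Psi> K n"
    unfolding prediction_error_def by (rule cSUP_upper[OF x bdd])
  finally show ?thesis .
qed

theorem lemma5:
  fixes M :: "(real ^ 'd) set" and m :: nat
    and T :: "real ^ 'd \<Rightarrow> real ^ 'd"
    and v :: nat and Minv :: "nat \<Rightarrow> (real ^ 'd) set"
    and Mp Mq :: "(real ^ 'd) set"
    and \<Psi> :: "real ^ 'd \<Rightarrow> complex ^ 'N"
    and K :: "complex ^ 'N ^ 'N"
    and \<nu> :: "complex ^ 'N \<Rightarrow> real"
    and n :: nat
  assumes "C1_submanifold m M" and "compact M"
    and "T ` M \<subseteq> M" and "C1_map_on M T"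
    and "\<forall>i\<in>{1..v}. invariant_subset M T (Minv i)"
    and "disjoint_family_on Minv {1..v}"
    and "\<forall>i. bounded ((\<lambda>x. \<Psi> x $ i) ` M)"
    and "koopman_invariant M T Mp \<Psi> K"
    and "is_vector_norm \<nu>"
    and "Mq \<subseteq> M" and "Mq \<noteq> {}"
  shows "prediction_error \<nu> T Mq \<Psi> K n \<ge> prediction_error \<nu> T Mp \<Psi> K n"
proof -
  have "bounded (\<Psi> ` M)"
    using assms(7) by (intro bounded_image_if_components_bounded) simp
  then have "0 \<le> prediction_error \<nu> T Mq \<Psi> K n"
    by (rule prediction_error_nonneg[OF assms(9) _ assms(3,10,11)])
  then show ?thesis
    using prediction_error_koopman_invariant[OF assms(8,9)] by simp
qed

end
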